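(* Let $R$ be a commutative ring with identity. Suppose that $G=(V,E)$ is a connected graph with edge-labeling function $\alpha:E\to\mathcal I$. Fix a vertex $v\in V$. Then every generalized spline $\mathbf{p}\in R_G$ can be written uniquely as $\mathbf{p}=r\mathbf{1}+\mathbf{p}^v$, where $\mathbf{p}^v$ is a generalized spline in $R_G$ satisfying $\mathbf{p}^v_v=0$ and $r\in R$ satisfies $r=\mathbf{p}_v$. In other words, if $M=\{\mathbf{p}\in R_G:\mathbf{p}_v=0\}$, then $R_G=R\mathbf{1}\oplus M$ as $R$-modules.
   Context: All graphs are finite, with no multiple edges, and edges join distinct vertices. For a commutative ring $R$ with identity and a graph $G=(V,E)$, an edge-labeling function is a map $\alpha:E\to\mathcal I$ into the set of nonzero ideals of $R$. The ring of generalized splines is $R_G=R_{G,\alpha}=\{\mathbf{p}\in\bigoplus_{u\in V}R : \mathbf{p}_u-\mathbf{p}_w\in\alpha(uw)\text{ for every edge }uw\in E\}$, viewed as an $R$-module by componentwise scaling. The element $\mathbf{1}\in R_G$ has $\mathbf{1}_u=1$ for all $u\in V$. *)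

theory Defs
  imports
    "HOL-Algebra.Module"
    "HOL-Algebra.AbelCoset"
    "HOL-Algebra.Ideal"
    "Graph_Theory.Graph_Theory"
begin

(* A finite simple graph is a symmetric loop-free pair digraph (pair_graph): the undirected
   edge uw is the pair of arcs (u, w), (w, u).  Labels are therefore given on the unordered
   pair {u, w}, so that both arcs of an edge carry the same ideal; the values of \<alpha> on sets
   that are not edges are irrelevant. *)
definition edge_labeling ::
    "('a, 'c) ring_scheme \<Rightarrow> 'v pair_pre_digraph \<Rightarrow> ('v set \<Rightarrow> 'a set) \<Rightarrow> bool" where
  "edge_labeling R G \<alpha> \<longleftrightarrow>
     (\<forall>u w. (u, w) \<in> parcs G \<longrightarrow> ideal (\<alpha> {u, w}) R \<and> \<alpha> {u, w} \<noteq> {\<zero>\<^bsub>R\<^esub>})"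

(* Elements of the direct sum of copies of R over the finite vertex set V are the extensional
   functions on V, so that equality in the carrier is equality of all V-components. *)
definition splines ::
    "('a, 'c) ring_scheme \<Rightarrow> 'v pair_pre_digraph \<Rightarrow> ('v set \<Rightarrow> 'a set) \<Rightarrow> ('a, 'v \<Rightarrow> 'a) module" where
  "splines R G \<alpha> =
     \<lparr> carrier = {p \<in> pverts G \<rightarrow>\<^sub>E carrier R.
                    \<forall>u w. (u, w) \<in> parcs G \<longrightarrow> p u \<ominus>\<^bsub>R\<^esub> p w \<in> \<alpha> {u, w}},
       monoid.mult = (\<lambda>p q. \<lambda>u\<in>pverts G. p u \<otimes>\<^bsub>R\<^esub> q u),
       one = (\<lambda>u\<in>pverts G. \<one>\<^bsub>R\<^esub>),
       zero = (\<lambda>u\<in>pverts G. \<zero>\<^bsub>R\<^esub>),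
       add = (\<lambda>p q. \<lambda>u\<in>pverts G. p u \<oplus>\<^bsub>R\<^esub> q u),
       smult = (\<lambda>r p. \<lambda>u\<in>pverts G. r \<otimes>\<^bsub>R\<^esub> p u) \<rparr>"

definition internal_direct_sum ::
    "('a, 'c) ring_scheme \<Rightarrow> ('a, 'b, 'd) module_scheme \<Rightarrow> 'b set \<Rightarrow> 'b set \<Rightarrow> bool" where
  "internal_direct_sum R N A B \<longleftrightarrow>
     Module.module R N \<and> submodule A R N \<and> submodule B R N \<and>
     A <+>\<^bsub>N\<^esub> B = carrier N \<and> A \<inter> B = {\<zero>\<^bsub>N\<^esub>}"

end

theory Submission
  imports Defs
begin

text \<open>Constant functions are splines, since every edge difference is zero and so lies in every
  ideal. Evaluation at \<open>v\<close> therefore splits off a constant from any spline: in p = r 1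
  + q with q vanishing at v, evaluating at v forces r = p_v, and then q = p - p_v 1 is forced as
  well. Conversely this q is a spline, because splines are closed under addition and scaling, and it
  vanishes at v. \<open>decomposition_iff\<close> packs both directions into one equivalence, which
  carries existence, uniqueness and the value of r. For the direct sum, the two summands are the
  image of R under r \<mapsto> r 1 (\<open>submodule_constants\<close>) and the kernel of evaluation
  at v (\<open>submodule_vanishing\<close>). They span by the decomposition, and a constant that
  vanishes at v is zero.\<close>

locale edge_labeled_digraph = cring R + pair_wf_digraph G
  for R :: "('a, 'c) ring_scheme" (structure) and G :: "'v pair_pre_digraph" +
  fixes \<alpha> :: "'v set \<Rightarrow> 'a set"
  assumes labeling: "edge_labeling R G \<alpha>"
begin

abbreviation S :: "('a, 'v \<Rightarrow> 'a) module" where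
  "S \<equiv> splines R G \<alpha>"

lemma ideal_label: "(u, w) \<in> parcs G \<Longrightarrow> ideal (\<alpha> {u, w}) R"
  using labeling by (simp add: edge_labeling_def)

lemma splinesI:
  assumes "p \<in> extensional (pverts G)"
    and "\<And>u. u \<in> pverts G \<Longrightarrow> p u \<in> carrier R"
    and "\<And>u w. (u, w) \<in> parcs G \<Longrightarrow> p u \<ominus> p w \<in> \<alpha> {u, w}"
  shows "p \<in> carrier S"
  using assms by (auto simp: splines_def PiE_def)

lemma splines_closed: "p \<in> carrier S \<Longrightarrow> u \<in> pverts G \<Longrightarrow> p u \<in> carrier R"
  by (auto simp: splines_def)

lemma splines_diff: "p \<in> carrier S \<Longrightarrow> (u, w) \<in> parcs G \<Longrightarrow> p u \<ominus> p w \<in> \<alpha> {u, w}"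
  by (auto simp: splines_def)

lemma splines_eqI:
  assumes "p \<in> carrier S" "q \<in> carrier S" "\<And>u. u \<in> pverts G \<Longrightarrow> p u = q u"
  shows "p = q"
  using assms by (auto simp: splines_def intro: PiE_ext)

lemma splines_simps:
  "\<zero>\<^bsub>S\<^esub> = (\<lambda>u\<in>pverts G. \<zero>)"
  "\<one>\<^bsub>S\<^esub> = (\<lambda>u\<in>pverts G. \<one>)"
  "p \<oplus>\<^bsub>S\<^esub> q = (\<lambda>u\<in>pverts G. p u \<oplus> q u)"
  "r \<odot>\<^bsub>S\<^esub> p = (\<lambda>u\<in>pverts G. r \<otimes> p u)"
  by (simp_all add: splines_def)

text \<open>Supplies the zero and one of \<open>S\<close>, and all multiples of the one.\<close>

lemma const_spline:
  assumes "r \<in> carrier R"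
  shows "(\<lambda>u\<in>pverts G. r) \<in> carrier S"
proof (rule splinesI)
  fix u w assume e: "(u, w) \<in> parcs G"
  interpret I: ideal "\<alpha> {u, w}" R using e by (rule ideal_label)
  show "(\<lambda>u\<in>pverts G. r) u \<ominus> (\<lambda>u\<in>pverts G. r) w \<in> \<alpha> {u, w}"
    using assms wellformed'[OF e] by (simp add: a_minus_def r_neg)
qed (use assms in auto)

text \<open>The edge difference of a sum regroups into the sum of the edge differences, and each
  label is closed under addition.\<close>

lemma add_spline:
  assumes "p \<in> carrier S" "q \<in> carrier S"
  shows "p \<oplus>\<^bsub>S\<^esub> q \<in> carrier S"
proof (rule splinesI)
  fix u w assume e: "(u, w) \<in> parcs G"
  interpret I: ideal "\<alpha> {u, w}" R using e by (rule ideal_label)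
  note V = wellformed'[OF e]
  note C = assms[THEN splines_closed, OF V(1)] assms[THEN splines_closed, OF V(2)]
  have "(p u \<oplus> q u) \<ominus> (p w \<oplus> q w) = (p u \<ominus> p w) \<oplus> (q u \<ominus> q w)"
    using C by algebra
  then show "(p \<oplus>\<^bsub>S\<^esub> q) u \<ominus> (p \<oplus>\<^bsub>S\<^esub> q) w \<in> \<alpha> {u, w}"
    using V I.a_closed[OF assms[THEN splines_diff, OF e]] by (simp add: splines_simps)
qed (use assms splines_closed in \<open>auto simp: splines_simps\<close>)

text \<open>The scalar factors out of the edge difference and is absorbed by the ideal.\<close>

lemma smult_spline:
  assumes "r \<in> carrier R" "p \<in> carrier S"
  shows "r \<odot>\<^bsub>S\<^esub> p \<in> carrier S"
proof (rule splinesI)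
  fix u w assume e: "(u, w) \<in> parcs G"
  interpret I: ideal "\<alpha> {u, w}" R using e by (rule ideal_label)
  note V = wellformed'[OF e]
  note C = assms(1) assms(2)[THEN splines_closed, OF V(1)] assms(2)[THEN splines_closed, OF V(2)]
  have "r \<otimes> p u \<ominus> r \<otimes> p w = r \<otimes> (p u \<ominus> p w)"
    using C by algebra
  then show "(r \<odot>\<^bsub>S\<^esub> p) u \<ominus> (r \<odot>\<^bsub>S\<^esub> p) w \<in> \<alpha> {u, w}"
    using V I.I_l_closed[OF splines_diff[OF assms(2) e] assms(1)] by (simp add: splines_simps)
qed (use assms splines_closed in \<open>auto simp: splines_simps\<close>)

lemma splines_module: "Module.module R S"
proof (rule moduleI)
  have zero: "\<zero>\<^bsub>S\<^esub> \<in> carrier S"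
    using const_spline[of \<zero>] by (simp add: splines_simps)
  show "abelian_group S"
  proof (rule abelian_groupI)
    fix p assume p: "p \<in> carrier S"
    \<comment> \<open>Scaling by -1 provides the additive inverse, so no separate closure proof
      under negation is required.\<close>
    have "(\<ominus> \<one>) \<odot>\<^bsub>S\<^esub> p \<oplus>\<^bsub>S\<^esub> p = \<zero>\<^bsub>S\<^esub>"
      using p by (auto simp: splines_simps splines_closed l_minus l_neg restrict_def)
    then show "\<exists>q\<in>carrier S. q \<oplus>\<^bsub>S\<^esub> p = \<zero>\<^bsub>S\<^esub>"
      using smult_spline[OF _ p, of "\<ominus> \<one>"] by blast
    show "\<zero>\<^bsub>S\<^esub> \<oplus>\<^bsub>S\<^esub> p = p"
      by (rule splines_eqI[OF add_spline[OF zero p] p])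
        (simp add: splines_simps splines_closed[OF p])
  next
    fix p q assume "p \<in> carrier S" "q \<in> carrier S"
    then show "p \<oplus>\<^bsub>S\<^esub> q = q \<oplus>\<^bsub>S\<^esub> p"
      by (auto simp: splines_simps splines_closed a_comm restrict_def)
  next
    fix p q s assume "p \<in> carrier S" "q \<in> carrier S" "s \<in> carrier S"
    then show "p \<oplus>\<^bsub>S\<^esub> q \<oplus>\<^bsub>S\<^esub> s = p \<oplus>\<^bsub>S\<^esub> (q \<oplus>\<^bsub>S\<^esub> s)"
      by (auto simp: splines_simps splines_closed a_assoc restrict_def)
  qed (use zero add_spline in auto)
  fix p assume p: "p \<in> carrier S"
  show "\<one> \<odot>\<^bsub>S\<^esub> p = p"
    by (rule splines_eqI[OF smult_spline[OF one_closed p] p])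
      (simp add: splines_simps splines_closed[OF p])
qed (use is_cring smult_spline in \<open>auto simp: splines_simps splines_closed l_distr r_distr m_assoc
       cong: restrict_cong\<close>)

lemma smult_one_spline: "r \<in> carrier R \<Longrightarrow> r \<odot>\<^bsub>S\<^esub> \<one>\<^bsub>S\<^esub> = (\<lambda>u\<in>pverts G. r)"
  by (auto simp: splines_simps restrict_def)

text \<open>For fixed \<open>p\<close>, the right side names exactly one pair, so the equivalence
  yields existence and uniqueness together. The element p - p_v 1 is written as a sum with a scalar
  multiple, not with the subtraction of \<open>S\<close>: addition and scaling are fields of the
  record, which \<open>splines_simps\<close> computes vertex by vertex.\<close>

lemma decomposition_iff:
  assumes v: "v \<in> pverts G" and p: "p \<in> carrier S"
  shows "r \<in> carrier R \<and> q \<in> carrier S \<and> q v = \<zero> \<and> p = r \<odot>\<^bsub>S\<^esub> \<one>\<^bsub>S\<^esub> \<oplus>\<^bsub>S\<^esub> q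
     \<longleftrightarrow> r = p v \<and> q = (\<ominus> p v) \<odot>\<^bsub>S\<^esub> \<one>\<^bsub>S\<^esub> \<oplus>\<^bsub>S\<^esub> p"
    (is "?L \<longleftrightarrow> ?R")
proof
  assume L: ?L
  then have p_eq: "p u = r \<oplus> q u" if "u \<in> pverts G" for u
    \<comment> \<open>Two passes: the multiple of the one must first become a constant function,
      before \<open>splines_simps\<close> unfolds the one itself.\<close>
    using that by (simp add: smult_one_spline) (simp add: splines_simps)
  have r: "r = p v" using p_eq[OF v] L by simp
  have "q = (\<ominus> r) \<odot>\<^bsub>S\<^esub> \<one>\<^bsub>S\<^esub> \<oplus>\<^bsub>S\<^esub> p"
  proof (rule splines_eqI)
    show "(\<ominus> r) \<odot>\<^bsub>S\<^esub> \<one>\<^bsub>S\<^esub> \<oplus>\<^bsub>S\<^esub> p \<in> carrier S"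
      using L p by (simp add: smult_one_spline const_spline add_spline)
    fix u assume "u \<in> pverts G"
    then show "q u = ((\<ominus> r) \<odot>\<^bsub>S\<^esub> \<one>\<^bsub>S\<^esub> \<oplus>\<^bsub>S\<^esub> p) u"
      using L splines_closed[of q u] p_eq[of u] by (simp add: splines_simps r_neg1)
  qed (use L in blast)
  with r show ?R by simp
next
  assume R: ?R
  note pv = splines_closed[OF p v]
  have q: "q \<in> carrier S"
    using R pv p by (simp add: smult_one_spline const_spline add_spline)
  have qv: "q v = \<zero>"
    using R pv v by (simp add: splines_simps l_neg)
  have "p = p v \<odot>\<^bsub>S\<^esub> \<one>\<^bsub>S\<^esub> \<oplus>\<^bsub>S\<^esub> q"
  proof (rule splines_eqI[OF p])
    show "p v \<odot>\<^bsub>S\<^esub> \<one>\<^bsub>S\<^esub> \<oplus>\<^bsub>S\<^esub> q \<in> carrier S"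
      using pv q by (simp add: smult_one_spline const_spline add_spline)
    fix u assume "u \<in> pverts G"
    then show "p u = (p v \<odot>\<^bsub>S\<^esub> \<one>\<^bsub>S\<^esub> \<oplus>\<^bsub>S\<^esub> q) u"
      using R pv splines_closed[OF p, of u] by (simp add: splines_simps r_neg2)
  qed
  with R pv q qv show ?L by simp
qed

text \<open>This set is the image of R under r \<mapsto> r 1. Each closure property is a module law
  at the one, read from right to left, which exhibits the new coefficient.\<close>

lemma submodule_constants: "submodule {r \<odot>\<^bsub>S\<^esub> \<one>\<^bsub>S\<^esub> | r. r \<in> carrier R} R S"
proof -
  interpret S: Module.module R S by (rule splines_module)
  have one: "\<one>\<^bsub>S\<^esub> \<in> carrier S"
    using const_spline[of \<one>] by (simp add: splines_simps)
  show ?thesis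
  proof (rule S.submoduleI)
    show "\<zero>\<^bsub>S\<^esub> \<in> {r \<odot>\<^bsub>S\<^esub> \<one>\<^bsub>S\<^esub> | r. r \<in> carrier R}"
      using S.smult_l_null[OF one] by force
    show "\<ominus>\<^bsub>S\<^esub> a \<in> {r \<odot>\<^bsub>S\<^esub> \<one>\<^bsub>S\<^esub> | r. r \<in> carrier R}"
      if "a \<in> {r \<odot>\<^bsub>S\<^esub> \<one>\<^bsub>S\<^esub> | r. r \<in> carrier R}" for a
      using that S.smult_l_minus[OF _ one, symmetric] by force
    show "a \<oplus>\<^bsub>S\<^esub> b \<in> {r \<odot>\<^bsub>S\<^esub> \<one>\<^bsub>S\<^esub> | r. r \<in> carrier R}"
      if "a \<in> {r \<odot>\<^bsub>S\<^esub> \<one>\<^bsub>S\<^esub> | r. r \<in> carrier R}"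
        "b \<in> {r \<odot>\<^bsub>S\<^esub> \<one>\<^bsub>S\<^esub> | r. r \<in> carrier R}" for a b
      using that S.smult_l_distr[OF _ _ one, symmetric] by force
    show "c \<odot>\<^bsub>S\<^esub> x \<in> {r \<odot>\<^bsub>S\<^esub> \<one>\<^bsub>S\<^esub> | r. r \<in> carrier R}"
      if "c \<in> carrier R" "x \<in> {r \<odot>\<^bsub>S\<^esub> \<one>\<^bsub>S\<^esub> | r. r \<in> carrier R}" for c x
      using that S.smult_assoc1[OF _ _ one, symmetric] by force
  qed (use one in auto)
qed

lemma submodule_vanishing:
  assumes v: "v \<in> pverts G"
  shows "submodule {p \<in> carrier S. p v = \<zero>} R S"
proof -
  interpret S: Module.module R S by (rule splines_module)
  \<comment> \<open>Stated in advance because closure under negation also rests on it: the negative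
    in \<open>S\<close> has no vertexwise formula at hand and is reached as scaling by -1.\<close>
  have smult: "r \<odot>\<^bsub>S\<^esub> p \<in> {p \<in> carrier S. p v = \<zero>}"
    if "r \<in> carrier R" "p \<in> {p \<in> carrier S. p v = \<zero>}" for r p
    using that smult_spline v by (auto simp: splines_simps)
  show ?thesis
  proof (rule S.submoduleI)
    show "\<ominus>\<^bsub>S\<^esub> a \<in> {p \<in> carrier S. p v = \<zero>}" if "a \<in> {p \<in> carrier S. p v = \<zero>}" for a
      using smult[OF _ that, of "\<ominus> \<one>"] that S.smult_l_minus[of \<one> a] by simp
    show "\<zero>\<^bsub>S\<^esub> \<in> {p \<in> carrier S. p v = \<zero>}"
      using v S.M.zero_closed by (simp add: splines_simps)
    show "a \<oplus>\<^bsub>S\<^esub> b \<in> {p \<in> carrier S. p v = \<zero>}"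
      if "a \<in> {p \<in> carrier S. p v = \<zero>}" "b \<in> {p \<in> carrier S. p v = \<zero>}" for a b
      using that add_spline v by (auto simp: splines_simps)
  qed (use smult in auto)
qed

lemma internal_direct_sum_splines:
  assumes v: "v \<in> pverts G"
  shows "internal_direct_sum R S
    {r \<odot>\<^bsub>S\<^esub> \<one>\<^bsub>S\<^esub> | r. r \<in> carrier R} {p \<in> carrier S. p v = \<zero>}"
    (is "internal_direct_sum R S ?A ?B")
proof -
  interpret S: Module.module R S by (rule splines_module)
  have "?A <+>\<^bsub>S\<^esub> ?B = carrier S"
  proof
    show "?A <+>\<^bsub>S\<^esub> ?B \<subseteq> carrier S"
      by (auto simp: set_add_def' smult_one_spline const_spline)
    \<comment> \<open>Spanning is the existence half of \<open>decomposition_iff\<close>.\<close>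
    show "carrier S \<subseteq> ?A <+>\<^bsub>S\<^esub> ?B"
    proof
      fix p assume p: "p \<in> carrier S"
      obtain r q where "r \<in> carrier R" "q \<in> carrier S" "q v = \<zero>"
        "p = r \<odot>\<^bsub>S\<^esub> \<one>\<^bsub>S\<^esub> \<oplus>\<^bsub>S\<^esub> q"
        using decomposition_iff[OF v p] by blast
      then show "p \<in> ?A <+>\<^bsub>S\<^esub> ?B"
        by (auto simp: set_add_def')
    qed
  qed
  moreover have "?A \<inter> ?B = {\<zero>\<^bsub>S\<^esub>}"
  proof
    \<comment> \<open>An element of both sets is a constant function whose value can be read off at
      \<open>v\<close>, where it is zero.\<close>
    show "?A \<inter> ?B \<subseteq> {\<zero>\<^bsub>S\<^esub>}"
      using v by (auto simp: smult_one_spline) (simp add: splines_simps)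
    show "{\<zero>\<^bsub>S\<^esub>} \<subseteq> ?A \<inter> ?B"
      using S.submoduleE(1)[OF submodule_constants] submodule_constants submodule_vanishing[OF v]
      \<comment> \<open>A submodule is a subgroup of the additive group, whose neutral element is
        the zero of \<open>S\<close>.\<close>
      by (auto dest!: submodule.axioms(1) subgroup.one_closed)
  qed
  ultimately show ?thesis
    unfolding internal_direct_sum_def
    using splines_module submodule_constants submodule_vanishing[OF v] by blast
qed

end

theorem theorem2p12:
  fixes R :: "('a, 'c) ring_scheme"
    and G :: "'v pair_pre_digraph"
    and \<alpha> :: "'v set \<Rightarrow> 'a set"
    and v :: 'v
  assumes "cring R"
    and "pair_graph G"
    and "Digraph_Component.connected (with_proj G)"
    and "edge_labeling R G \<alpha>"
    and "v \<in> pverts G"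
  shows "(\<forall>p \<in> carrier (splines R G \<alpha>).
            (\<exists>!rq. case rq of (r, q) \<Rightarrow>
               r \<in> carrier R \<and> q \<in> carrier (splines R G \<alpha>) \<and> q v = \<zero>\<^bsub>R\<^esub> \<and>
               p = r \<odot>\<^bsub>splines R G \<alpha>\<^esub> \<one>\<^bsub>splines R G \<alpha>\<^esub> \<oplus>\<^bsub>splines R G \<alpha>\<^esub> q) \<and>
            (\<forall>r q. r \<in> carrier R \<and> q \<in> carrier (splines R G \<alpha>) \<and> q v = \<zero>\<^bsub>R\<^esub> \<and>
               p = r \<odot>\<^bsub>splines R G \<alpha>\<^esub> \<one>\<^bsub>splines R G \<alpha>\<^esub> \<oplus>\<^bsub>splines R G \<alpha>\<^esub> q \<longrightarrow> r = p v))
       \<and> internal_direct_sum R (splines R G \<alpha>)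
            {r \<odot>\<^bsub>splines R G \<alpha>\<^esub> \<one>\<^bsub>splines R G \<alpha>\<^esub> | r. r \<in> carrier R}
            {p \<in> carrier (splines R G \<alpha>). p v = \<zero>\<^bsub>R\<^esub>}"
  proof -
  interpret pair_graph G by fact
  interpret edge_labeled_digraph R G \<alpha>
    using assms(1,4) pair_wf_digraph
    by (simp add: edge_labeled_digraph_def edge_labeled_digraph_axioms_def)
  \<comment> \<open>The equivalence turns the condition on \<open>rq\<close> into equations for its
    two components. Folding them back into one equation of pairs leaves the unique existence of an
    element equal to a given pair.\<close>
  show ?thesis
    using decomposition_iff[OF assms(5)] internal_direct_sum_splines[OF assms(5)]
    by (simp add: case_prod_unfold prod_eq_iff[of _ "(_, _)", simplified, symmetric])
qed

end
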